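(* (a) Every finite orthodox semigroup $S$ can be embedded in a finite orthodox semigroup $T$ that is generated (as a semigroup) by two group elements. (b) Every finite orthodox monoid $S$ can be embedded, as a semigroup, in a finite $2$-generated orthodox monoid $T$ such that the band of idempotents $E(T)$ satisfies the same semigroup identities as the band of idempotents $E(S)$.
   Context: A semigroup $S$ is regular if for each $a\in S$ there is $x\in S$ with $a=axa$. $E(S)$ denotes the set of idempotents of $S$. A semigroup is orthodox if it is regular and its idempotents form a subsemigroup (equivalently, a band). An embedding of $S$ in $T$ is an injective semigroup homomorphism $S\to T$; for monoids, "as a semigroup" means the embedding need not send the identity to the identity. A group element of a semigroup is an element lying in some subgroup of that semigroup. $2$-generated means generated, as a semigroup, by two elements. A semigroup identity is a formal equality $p=q$ of two nonempty words in variables; a semigroup satisfies it if equality holds under every substitution of elements of the semigroup for the variables. "$E(T)$ and $E(S)$ satisfy the same semigroup identities" means that, for every semigroup identity $p=q$, $E(T)$ satisfies $p=q$ if and only if $E(S)$ does. *)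

theory Defs
  imports "HOL-Algebra.Group"
begin

text \<open>
  A semigroup is a carrier set together with a binary operation, written as two separate
  parameters \<open>A\<close> and \<open>m\<close>, since the records of HOL-Algebra always include a distinguished unit.
  The empty semigroup is not excluded.
\<close>

locale semigroup_on =
  fixes A :: "'a set" and m :: "'a \<Rightarrow> 'a \<Rightarrow> 'a" (infixl "\<cdot>" 70)
  assumes closed: "x \<in> A \<Longrightarrow> y \<in> A \<Longrightarrow> x \<cdot> y \<in> A"
    and assoc: "x \<in> A \<Longrightarrow> y \<in> A \<Longrightarrow> z \<in> A \<Longrightarrow> (x \<cdot> y) \<cdot> z = x \<cdot> (y \<cdot> z)"

definition idempotents :: "'a set \<Rightarrow> ('a \<Rightarrow> 'a \<Rightarrow> 'a) \<Rightarrow> 'a set" where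
  "idempotents A m = {e \<in> A. m e e = e}"

definition regular_semigroup :: "'a set \<Rightarrow> ('a \<Rightarrow> 'a \<Rightarrow> 'a) \<Rightarrow> bool" where
  "regular_semigroup A m \<longleftrightarrow>
     semigroup_on A m \<and> (\<forall>a\<in>A. \<exists>x\<in>A. a = m (m a x) a)"

definition orthodox_semigroup :: "'a set \<Rightarrow> ('a \<Rightarrow> 'a \<Rightarrow> 'a) \<Rightarrow> bool" where
  "orthodox_semigroup A m \<longleftrightarrow>
     regular_semigroup A m \<and>
     (\<forall>e\<in>idempotents A m. \<forall>f\<in>idempotents A m. m e f \<in> idempotents A m)"

definition semigroup_embedding ::
    "('a \<Rightarrow> 'b) \<Rightarrow> 'a set \<Rightarrow> ('a \<Rightarrow> 'a \<Rightarrow> 'a) \<Rightarrow> 'b set \<Rightarrow> ('b \<Rightarrow> 'b \<Rightarrow> 'b) \<Rightarrow> bool" where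
  "semigroup_embedding h A m B n \<longleftrightarrow>
     h \<in> A \<rightarrow> B \<and> (\<forall>x\<in>A. \<forall>y\<in>A. h (m x y) = n (h x) (h y)) \<and> inj_on h A"

text \<open>The unit \<open>e\<close> of a subgroup need not be a unit of the ambient semigroup.\<close>

definition group_element :: "'a set \<Rightarrow> ('a \<Rightarrow> 'a \<Rightarrow> 'a) \<Rightarrow> 'a \<Rightarrow> bool" where
  "group_element A m a \<longleftrightarrow>
     (\<exists>H e. H \<subseteq> A \<and> group \<lparr>carrier = H, mult = m, one = e\<rparr> \<and> a \<in> H)"

inductive_set generated_subsemigroup :: "('a \<Rightarrow> 'a \<Rightarrow> 'a) \<Rightarrow> 'a set \<Rightarrow> 'a set"
  for m :: "'a \<Rightarrow> 'a \<Rightarrow> 'a" and X :: "'a set" where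
  gen: "x \<in> X \<Longrightarrow> x \<in> generated_subsemigroup m X"
| mult: "x \<in> generated_subsemigroup m X \<Longrightarrow> y \<in> generated_subsemigroup m X
           \<Longrightarrow> m x y \<in> generated_subsemigroup m X"

text \<open>As usual, the two generators are allowed to coincide.\<close>

definition two_generated :: "'a set \<Rightarrow> ('a \<Rightarrow> 'a \<Rightarrow> 'a) \<Rightarrow> bool" where
  "two_generated A m \<longleftrightarrow>
     (\<exists>x\<in>A. \<exists>y\<in>A. A = generated_subsemigroup m {x, y})"

definition generated_by_two_group_elements :: "'a set \<Rightarrow> ('a \<Rightarrow> 'a \<Rightarrow> 'a) \<Rightarrow> bool" where
  "generated_by_two_group_elements A m \<longleftrightarrow>
     (\<exists>x\<in>A. \<exists>y\<in>A. group_element A m x \<and> group_element A m y \<and>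
        A = generated_subsemigroup m {x, y})"

text \<open>
  A word is a list of variables, the variables being natural numbers.  Only nonempty words are
  evaluated; the value on the empty list is unspecified and never used.
\<close>

fun word_value :: "('a \<Rightarrow> 'a \<Rightarrow> 'a) \<Rightarrow> (nat \<Rightarrow> 'a) \<Rightarrow> nat list \<Rightarrow> 'a" where
  "word_value m \<sigma> [v] = \<sigma> v"
| "word_value m \<sigma> (v # w # ws) = m (\<sigma> v) (word_value m \<sigma> (w # ws))"

definition satisfies_identity ::
    "'a set \<Rightarrow> ('a \<Rightarrow> 'a \<Rightarrow> 'a) \<Rightarrow> nat list \<Rightarrow> nat list \<Rightarrow> bool" where
  "satisfies_identity A m p q \<longleftrightarrow>
     (\<forall>\<sigma>. range \<sigma> \<subseteq> A \<longrightarrow> word_value m \<sigma> p = word_value m \<sigma> q)"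

definition same_semigroup_identities ::
    "'a set \<Rightarrow> ('a \<Rightarrow> 'a \<Rightarrow> 'a) \<Rightarrow> 'b set \<Rightarrow> ('b \<Rightarrow> 'b \<Rightarrow> 'b) \<Rightarrow> bool" where
  "same_semigroup_identities A m B n \<longleftrightarrow>
     (\<forall>p q. p \<noteq> [] \<longrightarrow> q \<noteq> [] \<longrightarrow>
        (satisfies_identity A m p q \<longleftrightarrow> satisfies_identity B n p q))"

text \<open>
  HOL has no quantification over types, so an existential claim about finite semigroups
  is stated for semigroups whose carrier is a finite set of natural numbers.  Up to isomorphism these are
  all finite semigroups.
\<close>

end

theory Submission
  imports "HOL-Combinatorics.Permutations" Defs
begin

text \<open>
  Let \<open>S\<close> be a finite orthodox monoid. Partial monomial matrices over \<open>S\<close> (at most one nonzero entry in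
  each row and column) form a semigroup whose idempotents are the diagonal matrices with idempotent or
  zero entries, so these are closed under multiplication and satisfy the identities of \<open>E(S)\<close> with
  a zero adjoined. Since \<open>s\<close> and an inverse \<open>s'\<close> placed off the diagonal of a \<open>2 \<times> 2\<close> block
  give a group element of order two, all elements of \<open>S\<close> can be packed into a single group element
  \<open>a\<close>. Some rows of \<open>a\<close> are left zero and on many others \<open>a\<close> is the identity, so products of
  conjugates of \<open>a\<^sup>2\<close> by a cyclic permutation \<open>t\<close> yield all matrix units. Hence the orthodox
  semigroup generated by \<open>a\<close> and \<open>t\<close> contains the matrices with a single entry \<open>s\<close> in the corner.

  Part (a) applies this to \<open>S\<close> with a unit adjoined. In part (b), adjoining a zero to
  \<open>E(S)\<close> preserves its identities as soon as \<open>E(S)\<close> contains an idempotent other than the unit. Otherwise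
  \<open>S\<close> is a group, which embeds in a symmetric group.
\<close>

section \<open>Generated subsemigroups and group elements\<close>

lemma generated_subset:
  assumes "semigroup_on A m" "X \<subseteq> A"
  shows "generated_subsemigroup m X \<subseteq> A"
proof
  fix x assume "x \<in> generated_subsemigroup m X"
  then show "x \<in> A"
    by induction (use assms semigroup_on.closed in fastforce)+
qed

lemma semigroup_on_subset:
  assumes "semigroup_on A m" "B \<subseteq> A" "\<And>x y. x \<in> B \<Longrightarrow> y \<in> B \<Longrightarrow> m x y \<in> B"
  shows "semigroup_on B m"
  using assms unfolding semigroup_on_def by blast

lemma semigroup_on_generated:
  assumes "semigroup_on A m" "X \<subseteq> A"
  shows "semigroup_on (generated_subsemigroup m X) m"
  using assms generated_subset semigroup_on_subset generated_subsemigroup.mult by metis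

text \<open>The element \<open>y x\<close> works because \<open>e = (x a)(b y)\<close> is a product
  of idempotents, hence idempotent: \<open>a b = a e b = a e e b\<close>, and writing out
  \<open>e e\<close> and contracting \<open>a x a\<close> and \<open>b y b\<close> leaves
  \<open>(a b)(y x)(a b)\<close>.\<close>

lemma regular_mult:
  assumes "semigroup_on A m"
    and idem: "\<And>e f. e \<in> idempotents A m \<Longrightarrow> f \<in> idempotents A m \<Longrightarrow> m e f \<in> idempotents A m"
    and in_A: "a \<in> A" "b \<in> A" "x \<in> A" "y \<in> A"
    and a: "a = m (m a x) a" and b: "b = m (m b y) b"
  shows "m a b = m (m (m a b) (m y x)) (m a b)"
proof -
  interpret semigroup_on A m by fact
  \<comment> \<open>Once products are associated to the right, the regularity laws apply in front of
    a tail \<open>z\<close>, so they are stated in that form.\<close>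
  have cancel: "m a (m x (m a z)) = m a z" "m b (m y (m b z)) = m b z" if "z \<in> A" for z
  proof -
    have "m (m (m a x) a) z = m a z" "m (m (m b y) b) z = m b z" using a b by simp_all
    then show "m a (m x (m a z)) = m a z" "m b (m y (m b z)) = m b z"
      using that by (simp_all add: assoc closed in_A)
  qed
  have "m a (m x a) = a" "m b (m y b) = b" using a b by (simp_all add: assoc in_A)
  note cancel = cancel this
  have "m x a \<in> idempotents A m" "m b y \<in> idempotents A m"
    unfolding idempotents_def by (simp_all add: assoc closed in_A cancel)
  then have e: "m (m (m x a) (m b y)) (m (m x a) (m b y)) = m (m x a) (m b y)"
    using idem unfolding idempotents_def by blast
  have "m a b = m (m (m a x) a) (m (m b y) b)"
    using a b by simp
  also have "\<dots> = m (m a (m (m x a) (m b y))) b"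
    by (simp add: assoc closed in_A)
  also have "\<dots> = m (m a (m (m (m x a) (m b y)) (m (m x a) (m b y)))) b"
    by (simp only: e)
  also have "\<dots> = m (m (m a b) (m y x)) (m a b)"
    by (simp add: assoc closed in_A cancel)
  finally show ?thesis .
qed

text \<open>Regularity spreads from the generators to all products by \<open>regular_mult\<close>,
  with witnesses staying inside; closure of the idempotents is inherited from the ambient
  semigroup.\<close>

lemma orthodox_generated:
  assumes S: "semigroup_on A m"
    and idem: "\<And>e f. e \<in> idempotents A m \<Longrightarrow> f \<in> idempotents A m \<Longrightarrow> m e f \<in> idempotents A m"
    and X: "X \<subseteq> A"
    and reg: "\<And>a. a \<in> X \<Longrightarrow> \<exists>x\<in>generated_subsemigroup m X. a = m (m a x) a"
  shows "orthodox_semigroup (generated_subsemigroup m X) m"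
proof -
  let ?T = "generated_subsemigroup m X"
  note T = generated_subset[OF S X]
  have "\<exists>x\<in>?T. a = m (m a x) a" if "a \<in> ?T" for a
    using that
  proof induction
    case (gen x)
    then show ?case by (rule reg)
  next
    case (mult a b)
    then obtain x y where "x \<in> ?T" "y \<in> ?T" "a = m (m a x) a" "b = m (m b y) b" by blast
    moreover from this have "m a b = m (m (m a b) (m y x)) (m a b)"
      using regular_mult[OF S idem] T mult.hyps by blast
    ultimately show ?case using generated_subsemigroup.mult by metis
  qed
  moreover have "m e f \<in> idempotents ?T m"
    if "e \<in> idempotents ?T m" "f \<in> idempotents ?T m" for e f
    using that idem[of e f] T generated_subsemigroup.mult[of e m X f]
    unfolding idempotents_def by blast
  ultimately show ?thesis
    using semigroup_on_generated[OF S X]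
    unfolding orthodox_semigroup_def regular_semigroup_def by blast
qed

section \<open>Periodic elements and cyclic subgroups\<close>

text \<open>A semigroup has no zeroth power, so the exponent is shifted: the value is \<open>x\<^sup>k\<^sup>+\<^sup>1\<close>.\<close>

primrec suc_power :: "('a \<Rightarrow> 'a \<Rightarrow> 'a) \<Rightarrow> 'a \<Rightarrow> nat \<Rightarrow> 'a" where
  "suc_power m x 0 = x"
| "suc_power m x (Suc k) = m (suc_power m x k) x"

lemma suc_power_generated: "x \<in> X \<Longrightarrow> suc_power m x k \<in> generated_subsemigroup m X"
  by (induction k) (auto intro: generated_subsemigroup.intros)

lemma (in semigroup_on) suc_power_closed: "x \<in> A \<Longrightarrow> suc_power (\<cdot>) x k \<in> A"
  by (induction k) (auto intro: closed)

lemma (in semigroup_on) suc_power_add: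
  "x \<in> A \<Longrightarrow> suc_power (\<cdot>) x i \<cdot> suc_power (\<cdot>) x j = suc_power (\<cdot>) x (Suc (i + j))"
  by (induction j) (auto simp: suc_power_closed simp flip: assoc)

lemma (in semigroup_on) suc_power_period:
  assumes x: "x \<in> A" and k: "suc_power (\<cdot>) x k = x"
  shows "suc_power (\<cdot>) x (i + k * c) = suc_power (\<cdot>) x i"
proof (induction c)
  case (Suc c)
  have *: "suc_power (\<cdot>) x (j + k) = suc_power (\<cdot>) x j" for j
    by (induction j) (use k in auto)
  show ?case using *[of "i + k * c"] Suc by (simp add: algebra_simps)
qed simp

text \<open>With the shifted exponent the hypothesis reads \<open>x^(k+1) = x\<close>, so the powers
  of \<open>x\<close> form a cyclic group with unit \<open>x^k\<close>, written
  \<open>suc_power\<close> at \<open>k - 1\<close>.\<close>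

lemma (in semigroup_on) power_period_group_element:
  assumes x: "x \<in> A" and k: "suc_power (\<cdot>) x k = x" "k > 0"
  shows "group_element A (\<cdot>) x"
proof -
  let ?p = "suc_power (\<cdot>) x" and ?H = "range (suc_power (\<cdot>) x)"
  have add: "?p i \<cdot> ?p j = ?p (Suc (i + j))" for i j
    by (rule suc_power_add[OF x])
  have per: "?p (i + k * c) = ?p i" for i c
    by (rule suc_power_period[OF x k(1)])
  have one: "?p (k - 1) \<cdot> ?p i = ?p i" for i
    unfolding add using per[of i 1] k(2) by (simp add: add.commute)
  have "group \<lparr>carrier = ?H, mult = (\<cdot>), one = ?p (k - 1)\<rparr>"
  proof (rule groupI, goal_cases)
    case (1 x y)
    then show ?case by (auto simp: add simp del: suc_power.simps)
  next
    case (3 x y z)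
    then show ?case using suc_power_closed[OF x] assoc by auto
  next
    case (5 y)
    then obtain i where i: "y = ?p i" by auto
    have "1 * (i + 2) \<le> k * (i + 2)" using k(2) by (intro mult_le_mono1) simp
    then obtain c where "k * (i + 2) = i + 2 + c" by (auto dest: le_Suc_ex)
    \<comment> \<open>An inverse of \<open>x^(i+1)\<close> must raise the exponent to a multiple of
      \<open>k\<close>; this \<open>j\<close> raises it to \<open>k * (i + 3)\<close>.\<close>
    moreover define j where "j = k + c"
    ultimately have "Suc (j + i) = k - 1 + k * (i + 2)" using k(2) by simp
    then have "?p j \<cdot> y = ?p (k - 1)"
      unfolding i add using per[of "k - 1" "i + 2"] by simp
    then show ?case by auto
  qed (use one in auto)
  moreover have "?H \<subseteq> A" using suc_power_closed[OF x] by auto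
  moreover have "x \<in> ?H" using suc_power.simps(1) by (metis rangeI)
  ultimately show ?thesis unfolding group_element_def by blast
qed

lemma (in semigroup_on) power_period_regular:
  assumes x: "x \<in> A" and k: "suc_power (\<cdot>) x k = x" "k > 0"
  shows "\<exists>i. x = x \<cdot> suc_power (\<cdot>) x i \<cdot> x"
proof -
  obtain j where "k = Suc j" using k(2) gr0_implies_Suc by blast
  \<comment> \<open>Two periods are used because \<open>x^(k+1)\<close> has only two factors when
    \<open>k = 1\<close>; \<open>x^(2k+1)\<close> always has at least three.\<close>
  then have i: "k * 2 = Suc (Suc (2 * j))" by simp
  have "x = suc_power (\<cdot>) x (Suc (Suc (2 * j)))"
    using suc_power_period[OF x k(1), of 0 2] i by simp
  also have "\<dots> = x \<cdot> suc_power (\<cdot>) x (2 * j) \<cdot> x"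
    using suc_power_add[OF x, of 0 "2 * j"] by simp
  finally show ?thesis by blast
qed

text \<open>The regularity witness of each generator is a positive power of it and so lies in
  \<open>T\<close>; the same periods give subgroups inside \<open>T\<close>.\<close>

lemma orthodox_generated_by_two_group_elements:
  assumes S: "semigroup_on A m"
    and idem: "\<And>e f. e \<in> idempotents A m \<Longrightarrow> f \<in> idempotents A m \<Longrightarrow> m e f \<in> idempotents A m"
    and xy: "x \<in> A" "y \<in> A"
    and x: "suc_power m x k = x" "k > 0" and y: "suc_power m y l = y" "l > 0"
  defines "T \<equiv> generated_subsemigroup m {x, y}"
  shows "orthodox_semigroup T m \<and> generated_by_two_group_elements T m"
proof -
  have X: "{x, y} \<subseteq> A" using xy by simp
  have T: "x \<in> T" "y \<in> T" unfolding T_def by (auto intro: generated_subsemigroup.gen)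
  have sT: "semigroup_on T m" unfolding T_def by (rule semigroup_on_generated[OF S X])
  have "\<exists>z\<in>T. a = m (m a z) a" if "a \<in> {x, y}" for a
    using that semigroup_on.power_period_regular[OF S xy(1) x]
      semigroup_on.power_period_regular[OF S xy(2) y]
      suc_power_generated[of _ "{x, y}" m] unfolding T_def by blast
  then have "orthodox_semigroup T m"
    unfolding T_def using orthodox_generated[OF S idem X] by blast
  moreover have "generated_by_two_group_elements T m"
    using semigroup_on.power_period_group_element[OF sT T(1) x]
      semigroup_on.power_period_group_element[OF sT T(2) y] T
    unfolding generated_by_two_group_elements_def T_def by blast
  ultimately show ?thesis by blast
qed

section \<open>Transfer along embeddings\<close>

lemma word_value_Cons:
  "p \<noteq> [] \<Longrightarrow> word_value m \<sigma> (v # p) = m (\<sigma> v) (word_value m \<sigma> p)"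
  by (cases p) auto

lemma word_value_closed:
  "semigroup_on A m \<Longrightarrow> p \<noteq> [] \<Longrightarrow> range \<sigma> \<subseteq> A \<Longrightarrow> word_value m \<sigma> p \<in> A"
proof (induction m \<sigma> p rule: word_value.induct)
  case (2 m \<sigma> v w ws)
  interpret semigroup_on A m by fact
  show ?case using 2 by (auto intro!: closed)
qed auto

lemma word_value_embedding:
  assumes "semigroup_on A m" "semigroup_embedding h A m B n" "range \<sigma> \<subseteq> A" "p \<noteq> []"
  shows "word_value n (h \<circ> \<sigma>) p = h (word_value m \<sigma> p)"
  using assms
proof (induction m \<sigma> p rule: word_value.induct)
  case (2 m \<sigma> v w ws)
  then show ?case
    using word_value_closed[OF 2(2), of "w # ws" \<sigma>]
    unfolding semigroup_embedding_def by (auto simp: image_subset_iff)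
qed auto

text \<open>A substitution into \<open>A\<close> composed with \<open>h\<close> is one into
  \<open>B\<close>, and injectivity of \<open>h\<close> pulls the equality of values back.\<close>

lemma satisfies_identity_embedding:
  assumes "semigroup_on A m" "semigroup_embedding h A m B n" "p \<noteq> []" "q \<noteq> []"
    and "satisfies_identity B n p q"
  shows "satisfies_identity A m p q"
  unfolding satisfies_identity_def
proof (intro allI impI)
  fix \<sigma> :: "nat \<Rightarrow> _" assume \<sigma>: "range \<sigma> \<subseteq> A"
  then have "range (h \<circ> \<sigma>) \<subseteq> B"
    using assms(2) unfolding semigroup_embedding_def by auto
  then have "h (word_value m \<sigma> p) = h (word_value m \<sigma> q)"
    using assms \<sigma> word_value_embedding unfolding satisfies_identity_def by metis
  then show "word_value m \<sigma> p = word_value m \<sigma> q"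
    using assms \<sigma> word_value_closed unfolding semigroup_embedding_def inj_on_def
    by metis
qed

lemma semigroup_idempotents:
  "orthodox_semigroup A m \<Longrightarrow> semigroup_on (idempotents A m) m"
  unfolding orthodox_semigroup_def regular_semigroup_def
  by (elim conjE, rule semigroup_on_subset) (auto simp: idempotents_def)

lemma semigroup_embedding_idempotents:
  "semigroup_embedding h A m B n \<Longrightarrow>
     semigroup_embedding h (idempotents A m) m (idempotents B n) n"
  unfolding semigroup_embedding_def idempotents_def
  by (auto simp: Pi_iff intro: inj_on_subset) metis

lemma semigroup_embedding_comp:
  "semigroup_embedding h A m B n \<Longrightarrow> semigroup_embedding f B n C r \<Longrightarrow>
     semigroup_embedding (f \<circ> h) A m C r"
  unfolding semigroup_embedding_def by (auto simp: Pi_iff intro!: comp_inj_on inj_on_subset[of f B])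

text \<open>The target carrier is the image of \<open>A\<close> under \<open>f\<close>. The locale
  moves the finite semigroups constructed below onto sets of natural numbers.\<close>

locale semigroup_isomorphism = semigroup_on A m
  for A :: "'a set" and m (infixl "\<cdot>" 70) +
  fixes f :: "'a \<Rightarrow> 'b" and n :: "'b \<Rightarrow> 'b \<Rightarrow> 'b"
  assumes inj: "inj_on f A"
    and hom: "x \<in> A \<Longrightarrow> y \<in> A \<Longrightarrow> f (x \<cdot> y) = n (f x) (f y)"
begin

lemma embedding: "semigroup_embedding f A (\<cdot>) (f ` A) n"
  unfolding semigroup_embedding_def using inj hom by auto

lemma embedding_inverse: "semigroup_embedding (inv_into A f) (f ` A) n A (\<cdot>)"
  unfolding semigroup_embedding_def
  using inj by (auto simp: hom[symmetric] closed inj_on_inv_into)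

lemma semigroup_image: "semigroup_on (f ` A) n"
  by unfold_locales (auto simp: hom[symmetric] closed assoc)

lemma idempotents_image: "idempotents (f ` A) n = f ` idempotents A (\<cdot>)"
  using inj unfolding idempotents_def
  by (auto simp: hom[symmetric] closed inj_on_eq_iff)

lemma orthodox_image:
  assumes "orthodox_semigroup A (\<cdot>)"
  shows "orthodox_semigroup (f ` A) n"
proof -
  have "\<exists>y\<in>f ` A. a = n (n a y) a" if "a \<in> f ` A" for a
  proof -
    from that obtain b where b: "b \<in> A" "a = f b" by auto
    with assms obtain x where "x \<in> A" "b = b \<cdot> x \<cdot> b"
      unfolding orthodox_semigroup_def regular_semigroup_def by blast
    with b have "a = n (n a (f x)) a" by (metis hom closed)
    with \<open>x \<in> A\<close> show ?thesis by blast
  qed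
  moreover have "n e e' \<in> f ` idempotents A (\<cdot>)"
    if "e \<in> f ` idempotents A (\<cdot>)" "e' \<in> f ` idempotents A (\<cdot>)" for e e'
  proof -
    from that obtain d d' where d: "d \<in> idempotents A (\<cdot>)" "d' \<in> idempotents A (\<cdot>)"
      "e = f d" "e' = f d'" by auto
    then have "n e e' = f (d \<cdot> d')" by (auto simp: hom idempotents_def)
    with d assms show ?thesis unfolding orthodox_semigroup_def by blast
  qed
  ultimately show ?thesis
    unfolding orthodox_semigroup_def regular_semigroup_def idempotents_image
    using semigroup_image by blast
qed

lemma generated_image:
  assumes "X \<subseteq> A"
  shows "generated_subsemigroup n (f ` X) = f ` generated_subsemigroup (\<cdot>) X"
proof
  have G: "generated_subsemigroup (\<cdot>) X \<subseteq> A"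
    using generated_subset assms semigroup_on_axioms by blast
  show "generated_subsemigroup n (f ` X) \<subseteq> f ` generated_subsemigroup (\<cdot>) X"
  proof
    fix x assume "x \<in> generated_subsemigroup n (f ` X)"
    then show "x \<in> f ` generated_subsemigroup (\<cdot>) X"
    proof induction
      case (gen x)
      then show ?case by (auto intro: generated_subsemigroup.gen)
    next
      case (mult x y)
      then obtain a b where ab: "a \<in> generated_subsemigroup (\<cdot>) X"
        "b \<in> generated_subsemigroup (\<cdot>) X" "x = f a" "y = f b" by auto
      then have "n x y = f (a \<cdot> b)" using G hom by (metis subsetD)
      then show ?case using generated_subsemigroup.mult[OF ab(1,2)] by simp
    qed
  qed
  show "f ` generated_subsemigroup (\<cdot>) X \<subseteq> generated_subsemigroup n (f ` X)"
  proof
    fix y assume "y \<in> f ` generated_subsemigroup (\<cdot>) X"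
    then obtain x where "x \<in> generated_subsemigroup (\<cdot>) X" "y = f x" by auto
    then show "y \<in> generated_subsemigroup n (f ` X)"
    proof (induction arbitrary: y)
      case (gen x)
      then show ?case by (auto intro: generated_subsemigroup.gen)
    next
      case (mult a b)
      then have "y = n (f a) (f b)" using hom G by (metis subsetD)
      with mult.IH show ?case by (simp add: generated_subsemigroup.mult)
    qed
  qed
qed

lemma group_element_image:
  assumes "group_element A (\<cdot>) a"
  shows "group_element (f ` A) n (f a)"
proof -
  obtain H e where H: "H \<subseteq> A" "group \<lparr>carrier = H, mult = (\<cdot>), one = e\<rparr>" "a \<in> H"
    using assms unfolding group_element_def by blast
  let ?G = "\<lparr>carrier = H, mult = (\<cdot>), one = e\<rparr>"
  interpret G: group ?G by (rule H(2))
  have e: "e \<in> H" "\<And>x. x \<in> H \<Longrightarrow> e \<cdot> x = x" and cl: "\<And>x y. x \<in> H \<Longrightarrow> y \<in> H \<Longrightarrow> x \<cdot> y \<in> H"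
    using G.one_closed G.l_one G.m_closed by auto
  have h: "n (f x) (f y) = f (x \<cdot> y)" if "x \<in> H" "y \<in> H" for x y
    using that H(1) by (simp add: hom subset_iff)
  have "group \<lparr>carrier = f ` H, mult = n, one = f e\<rparr>"
  proof (rule groupI, goal_cases)
    case (3 x y z)
    then obtain a b c where abc: "a \<in> H" "b \<in> H" "c \<in> H" "x = f a" "y = f b" "z = f c" by auto
    then have "a \<cdot> b \<cdot> c = a \<cdot> (b \<cdot> c)" using H(1) assoc by blast
    then show ?case using abc by (simp add: h cl)
  next
    case (5 x)
    then obtain y where y: "y \<in> H" "x = f y" by auto
    obtain z where "z \<in> H" "z \<cdot> y = e" using G.l_inv_ex[of y] y by auto
    then show ?case using y by (auto simp: h)
  qed (auto simp: h cl e)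
  then show ?thesis using H unfolding group_element_def by blast
qed

lemma generated_by_two_image:
  "x \<in> A \<Longrightarrow> y \<in> A \<Longrightarrow> A = generated_subsemigroup (\<cdot>) {x, y} \<Longrightarrow>
     f ` A = generated_subsemigroup n {f x, f y}"
  using generated_image[of "{x, y}"] by simp

lemma two_generated_image: "two_generated A (\<cdot>) \<Longrightarrow> two_generated (f ` A) n"
  unfolding two_generated_def using generated_by_two_image by blast

lemma generated_by_two_group_elements_image:
  "generated_by_two_group_elements A (\<cdot>) \<Longrightarrow> generated_by_two_group_elements (f ` A) n"
  unfolding generated_by_two_group_elements_def
  using generated_by_two_image group_element_image by blast

lemma same_identities_image:
  assumes "orthodox_semigroup A (\<cdot>)"
  shows "same_semigroup_identities (idempotents (f ` A) n) n (idempotents A (\<cdot>)) (\<cdot>)"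
  unfolding same_semigroup_identities_def
  using satisfies_identity_embedding[OF semigroup_idempotents[OF assms]
      semigroup_embedding_idempotents[OF embedding]]
    satisfies_identity_embedding[OF semigroup_idempotents[OF orthodox_image[OF assms]]
      semigroup_embedding_idempotents[OF embedding_inverse]] by blast

end

lemma finite_semigroup_nat:
  assumes "semigroup_on A m" "finite A"
  obtains f :: "'a \<Rightarrow> nat" and n where "semigroup_isomorphism A m f n"
proof -
  obtain f :: "'a \<Rightarrow> nat" where f: "inj_on f A"
    using finite_imp_inj_to_nat_seg[OF assms(2)] by blast
  then have "semigroup_isomorphism A m f (\<lambda>x y. f (m (inv_into A f x) (inv_into A f y)))"
    using assms(1) unfolding semigroup_isomorphism_def semigroup_isomorphism_axioms_def by simp
  then show ?thesis by (rule that)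
qed

section \<open>Partial monomial matrices\<close>

text \<open>
  A partial function \<open>f\<close> with \<open>f i = Some (j, s)\<close> encodes the matrix over \<open>A \<union> {0}\<close> whose only
  nonzero entry in row \<open>i\<close> is \<open>s\<close>, in column \<open>j\<close>; a row with \<open>f i = None\<close> is zero.
\<close>

type_synonym 'a monomial = "nat \<Rightarrow> (nat \<times> 'a) option"

text \<open>This is the matrix product: the entry \<open>s\<close> in column \<open>j\<close>
  selects row \<open>j\<close> of \<open>g\<close> and multiplies its entry from the left.\<close>

definition monomial_mult :: "('a \<Rightarrow> 'a \<Rightarrow> 'a) \<Rightarrow> 'a monomial \<Rightarrow> 'a monomial \<Rightarrow> 'a monomial" where
  "monomial_mult m f g =
     (\<lambda>i. Option.bind (f i) (\<lambda>(j, s). map_option (\<lambda>(k, t). (k, m s t)) (g j)))"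

text \<open>The last clause bounds the columns; at most one entry per row is built into the
  encoding.\<close>

definition monomials :: "nat \<Rightarrow> 'a set \<Rightarrow> 'a monomial set" where
  "monomials n A = {f. (\<forall>i. f i \<noteq> None \<longrightarrow> i < n) \<and>
     (\<forall>i j s. f i = Some (j, s) \<longrightarrow> j < n \<and> s \<in> A) \<and>
     (\<forall>i i' j s s'. f i = Some (j, s) \<longrightarrow> f i' = Some (j, s') \<longrightarrow> i = i')}"

lemma monomial_mult_None [simp]: "f i = None \<Longrightarrow> monomial_mult m f g i = None"
  by (simp add: monomial_mult_def)

lemma monomial_mult_Some [simp]:
  "f i = Some (j, s) \<Longrightarrow> monomial_mult m f g i = map_option (\<lambda>(k, t). (k, m s t)) (g j)"
  by (simp add: monomial_mult_def)

lemma monomial_mult_eq_Some: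
  "monomial_mult m f g i = Some (k, r) \<longleftrightarrow>
     (\<exists>j s t. f i = Some (j, s) \<and> g j = Some (k, t) \<and> r = m s t)"
  by (auto simp: monomial_mult_def bind_eq_Some_conv)

lemma monomial_mult_eq_None:
  "monomial_mult m f g i = None \<longleftrightarrow> f i = None \<or> (\<exists>j s. f i = Some (j, s) \<and> g j = None)"
  by (cases "f i") auto

lemma monomialsD:
  assumes "f \<in> monomials n A"
  shows "f i = Some (j, s) \<Longrightarrow> i < n" "f i = Some (j, s) \<Longrightarrow> j < n" "f i = Some (j, s) \<Longrightarrow> s \<in> A"
    "f i = Some (j, s) \<Longrightarrow> f i' = Some (j, s') \<Longrightarrow> i = i'"
  using assms unfolding monomials_def by blast+

lemma finite_monomials:
  assumes "finite A"
  shows "finite (monomials n A)"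
proof -
  have "finite {f. \<forall>i. (i \<in> {..<n} \<longrightarrow> f i \<in> insert None (Some ` ({..<n} \<times> A))) \<and>
    (i \<notin> {..<n} \<longrightarrow> f i = None)}"
    using assms by (intro finite_set_of_finite_funs) auto
  moreover have "f i \<in> insert None (Some ` ({..<n} \<times> A))" if "f \<in> monomials n A" for f i
    using monomialsD[OF that] by (cases "f i") auto
  moreover have "f i = None" if "f \<in> monomials n A" "i \<notin> {..<n}" for f i
    using monomialsD[OF that(1)] that(2) by (cases "f i") auto
  ultimately show ?thesis by (elim finite_subset[rotated]) blast
qed

context semigroup_on
begin

lemma semigroup_monomials: "semigroup_on (monomials n A) (monomial_mult (\<cdot>))"
proof
  fix f g assume fg: "f \<in> monomials n A" "g \<in> monomials n A"
  show "monomial_mult (\<cdot>) f g \<in> monomials n A"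
    unfolding monomials_def
  proof (intro CollectI conjI allI impI, goal_cases)
    case (1 i)
    then show ?case using monomialsD(1)[OF fg(1)] by (cases "f i") auto
  next
    case (2 i j s)
    then show ?case using monomialsD(2)[OF fg(2)] by (auto simp: monomial_mult_eq_Some)
  next
    case (3 i j s)
    then show ?case using monomialsD(3)[OF fg(1)] monomialsD(3)[OF fg(2)] closed
      by (auto simp: monomial_mult_eq_Some)
  next
    case (4 i i' j s s')
    then show ?case using monomialsD(4)[OF fg(1)] monomialsD(4)[OF fg(2)]
      by (simp add: monomial_mult_eq_Some) metis
  qed
  fix h assume h: "h \<in> monomials n A"
  show "monomial_mult (\<cdot>) (monomial_mult (\<cdot>) f g) h = monomial_mult (\<cdot>) f (monomial_mult (\<cdot>) g h)"
  proof
    fix i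
    show "monomial_mult (\<cdot>) (monomial_mult (\<cdot>) f g) h i
      = monomial_mult (\<cdot>) f (monomial_mult (\<cdot>) g h) i"
    proof (cases "f i")
      case fi: (Some a)
      then obtain j s where s: "f i = Some (j, s)" by (cases a) auto
      show ?thesis
      proof (cases "g j")
        case (Some b)
        then obtain l t where t: "g j = Some (l, t)" by (cases b) auto
        then show ?thesis
          using s assoc monomialsD(3)[OF fg(1) s] monomialsD(3)[OF fg(2) t] monomialsD(3)[OF h]
          by (cases "h l") auto
      qed (simp add: s)
    qed simp
  qed
qed

text \<open>If row \<open>i\<close> has its entry in column \<open>j\<close>, idempotency forces row
  \<open>j\<close> to have its entry in column \<open>j\<close> too, and the column condition gives
  \<open>i = j\<close>. A diagonal matrix is idempotent exactly when its entries are.\<close>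

lemma idempotent_monomials:
  "idempotents (monomials n A) (monomial_mult (\<cdot>)) =
     {f \<in> monomials n A. \<forall>i j s. f i = Some (j, s) \<longrightarrow> j = i \<and> s \<in> idempotents A (\<cdot>)}"
  (is "?E = ?D")
proof
  show "?E \<subseteq> ?D"
  proof
    fix f assume "f \<in> ?E"
    then have f: "f \<in> monomials n A" and ff: "monomial_mult (\<cdot>) f f = f"
      by (auto simp: idempotents_def)
    have "j = i \<and> s \<in> idempotents A (\<cdot>)" if fi: "f i = Some (j, s)" for i j s
    proof -
      have "monomial_mult (\<cdot>) f f i = Some (j, s)" using fi ff by simp
      then obtain t where t: "f j = Some (j, t)" "s = s \<cdot> t"
        using fi by (auto simp: monomial_mult_eq_Some)
      then have "j = i" using monomialsD(4)[OF f] fi by blast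
      then show ?thesis using t fi monomialsD(3)[OF f fi] by (auto simp: idempotents_def)
    qed
    with f show "f \<in> ?D" by blast
  qed
  show "?D \<subseteq> ?E"
  proof
    fix f assume f: "f \<in> ?D"
    have "monomial_mult (\<cdot>) f f i = f i" for i
    proof (cases "f i")
      case (Some js)
      then obtain s where "f i = Some (i, s)" "s \<in> idempotents A (\<cdot>)" using f by (cases js) auto
      then show ?thesis by (simp add: idempotents_def)
    qed simp
    then show "f \<in> ?E" using f by (auto simp: idempotents_def)
  qed
qed

lemma idempotent_monomials_mult:
  assumes "orthodox_semigroup A (\<cdot>)"
    and "e \<in> idempotents (monomials n A) (monomial_mult (\<cdot>))"
    and "f \<in> idempotents (monomials n A) (monomial_mult (\<cdot>))"
  shows "monomial_mult (\<cdot>) e f \<in> idempotents (monomials n A) (monomial_mult (\<cdot>))"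
proof -
  have "s \<cdot> t \<in> idempotents A (\<cdot>)" if "s \<in> idempotents A (\<cdot>)" "t \<in> idempotents A (\<cdot>)" for s t
    using assms(1) that unfolding orthodox_semigroup_def by blast
  moreover have "monomial_mult (\<cdot>) e f \<in> monomials n A"
    using assms semigroup_on.closed[OF semigroup_monomials] unfolding idempotents_def by blast
  ultimately show ?thesis
    using assms(2,3) unfolding idempotent_monomials
    by (simp add: monomial_mult_eq_Some) metis
qed

text \<open>Diagonal matrices multiply row by row, with \<open>None\<close> as an absorbing zero.
  The filler \<open>d\<close> keeps the substitution total; in the branch with a value, no variable
  of \<open>p\<close> takes it.\<close>

lemma word_value_monomials:
  assumes "p \<noteq> []" "range \<sigma> \<subseteq> idempotents (monomials n A) (monomial_mult (\<cdot>))"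
  shows "word_value (monomial_mult (\<cdot>)) \<sigma> p i =
    (if \<forall>v\<in>set p. \<sigma> v i \<noteq> None
     then Some (i, word_value (\<cdot>) (\<lambda>v. case \<sigma> v i of None \<Rightarrow> d | Some (_, s) \<Rightarrow> s) p) else None)"
  using assms(1)
proof (induction p rule: list_nonempty_induct)
  have diag: "j = i" if "\<sigma> v i = Some (j, s)" for v j s
    using assms(2) that unfolding idempotent_monomials by (auto simp: image_subset_iff)
  {
    case (single v)
    then show ?case using diag by (auto split: option.split)
  next
    case (cons v p)
    note step = word_value_Cons[OF cons.hyps(1)]
    show ?case
    proof (cases "\<sigma> v i")
      case (Some js)
      then obtain s where "\<sigma> v i = Some (i, s)" using diag by (cases js) auto
      then show ?thesis using cons.IH by (simp add: step)
    qed (simp add: step)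
  }
qed

end

section \<open>Embedding a finite orthodox monoid\<close>

text \<open>Here \<open>g\<close> lists \<open>A\<close> and \<open>g' i\<close> is an inverse of
  \<open>g i\<close>. Indices start at 1 because row 0 of \<open>swap\<close> is to vanish.\<close>

locale enumerated_orthodox_monoid = semigroup_on A m
  for A :: "'a set" and m (infixl "\<cdot>" 70) +
  fixes u :: 'a and k :: nat and g g' :: "nat \<Rightarrow> 'a"
  assumes orthodox: "orthodox_semigroup A (\<cdot>)"
    and unit: "u \<in> A" "x \<in> A \<Longrightarrow> u \<cdot> x = x" "x \<in> A \<Longrightarrow> x \<cdot> u = x"
    and enum: "g ` {1..k} = A" "i \<in> {1..k} \<Longrightarrow> g' i \<in> A"
    and inverse: "i \<in> {1..k} \<Longrightarrow> g i \<cdot> g' i \<cdot> g i = g i" "i \<in> {1..k} \<Longrightarrow> g' i \<cdot> g i \<cdot> g' i = g' i"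
begin

abbreviation mm (infixl "\<odot>" 70) where "mm \<equiv> monomial_mult (\<cdot>)"

text \<open>Large enough that two numbers up to \<open>2 * k + 1\<close> can be added without
  wrapping modulo \<open>n\<close>.\<close>

definition n where "n = 6 * k + 3"

definition rot :: "nat \<Rightarrow> 'a monomial" where
  "rot j = (\<lambda>i. if i < n then Some ((i + j) mod n, u) else None)"

text \<open>
  The block of \<open>swap\<close> on \<open>{i, i + k}\<close> has \<open>g i\<close> and \<open>g' i\<close> off the diagonal, which makes \<open>swap\<close> a
  group element although \<open>g i\<close> need not be one.  The rows \<open>0\<close> and \<open>2 * k + 1\<close> vanish; they are
  placed so that any two rows can be rotated with one landing on a vanishing row and the other on
  a row where \<open>swap\<close> is the identity.
\<close>

definition swap :: "'a monomial" where
  "swap = (\<lambda>i. if 1 \<le> i \<and> i \<le> k then Some (i + k, g i)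
     else if k < i \<and> i \<le> 2 * k then Some (i - k, g' (i - k))
     else if 2 * k + 1 < i \<and> i < n then Some (i, u) else None)"

definition entry :: "nat \<Rightarrow> nat \<Rightarrow> 'a \<Rightarrow> 'a monomial" where
  "entry i j s = (\<lambda>l. if l = i then Some (j, s) else None)"

definition T where "T = generated_subsemigroup (\<odot>) {rot 1, swap}"

section \<open>The two generators and their periods\<close>

lemma enum_closed: "1 \<le> i \<Longrightarrow> i \<le> k \<Longrightarrow> g i \<in> A \<and> g' i \<in> A"
  using enum by auto

lemma rot_monomial: "rot 1 \<in> monomials n A"
  unfolding monomials_def rot_def using unit(1)
  by (auto split: if_splits simp: mod_Suc)

lemma swap_monomial: "swap \<in> monomials n A"
  unfolding monomials_def
proof (intro CollectI conjI allI impI, goal_cases)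
  case (1 i)
  then show ?case by (auto simp: swap_def n_def split: if_splits)
next
  case (2 i j s)
  then show ?case by (auto simp: swap_def n_def split: if_splits)
next
  case (3 i j s)
  then show ?case using enum_closed[of i] enum_closed[of "i - k"] unit(1)
    by (auto simp: swap_def split: if_splits)
next
  case (4 i i' j s s')
  then show ?case by (auto simp: swap_def split: if_splits)
qed

lemma T_monomials: "T \<subseteq> monomials n A"
  unfolding T_def using generated_subset[OF semigroup_monomials] rot_monomial swap_monomial by simp

lemma T_mult: "f \<in> T \<Longrightarrow> h \<in> T \<Longrightarrow> f \<odot> h \<in> T"
  unfolding T_def by (rule generated_subsemigroup.mult)

lemma rot_mult: "rot i \<odot> rot j = rot (i + j)"
proof
  fix l show "(rot i \<odot> rot j) l = rot (i + j) l"
    using unit by (simp add: rot_def monomial_mult_def mod_add_left_eq add.assoc n_def)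
qed

lemma rot_period: "rot (j + n) = rot j"
  by (simp add: rot_def fun_eq_iff add.assoc[symmetric])

lemma suc_power_rot: "suc_power (\<odot>) (rot 1) j = rot (Suc j)"
  by (induction j) (auto simp: rot_mult)

lemma rot_T: "rot j \<in> T"
proof -
  \<comment> \<open>Adding \<open>n\<close> makes the shift positive, so that \<open>rot 0\<close>
    is also reached as a genuine power.\<close>
  have "Suc (j + n - 1) = j + n" by (simp add: n_def)
  then have "rot (j + n) = suc_power (\<odot>) (rot 1) (j + n - 1)"
    unfolding suc_power_rot by simp
  then show ?thesis
    unfolding rot_period T_def by (simp add: suc_power_generated)
qed

lemma rot_one: "f \<in> monomials n A \<Longrightarrow> rot 0 \<odot> f = f \<and> f \<odot> rot 0 = f"
proof (intro conjI ext)
  fix i assume f: "f \<in> monomials n A"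
  show "(rot 0 \<odot> f) i = f i"
    using monomialsD(1)[OF f, of i] monomialsD(3)[OF f, of i] unit
    by (cases "f i") (auto simp: monomial_mult_def rot_def)
  show "(f \<odot> rot 0) i = f i"
    using monomialsD(2)[OF f, of i] monomialsD(3)[OF f, of i] unit
    by (cases "f i") (auto simp: rot_def)
qed

lemma swap_square:
  "(swap \<odot> swap) i = (if 1 \<le> i \<and> i \<le> k then Some (i, g i \<cdot> g' i)
     else if k < i \<and> i \<le> 2 * k then Some (i, g' (i - k) \<cdot> g (i - k))
     else if 2 * k + 1 < i \<and> i < n then Some (i, u) else None)"
  using unit by (auto simp: monomial_mult_def swap_def)

text \<open>On each block this is the pair of equations \<open>g g' g = g\<close> and
  \<open>g' g g' = g'\<close>; it shows that \<open>swap\<close> has period 2.\<close>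

lemma swap_cube: "(swap \<odot> swap) \<odot> swap = swap"
proof
  fix i
  have "g' (i - k) \<cdot> g (i - k) \<cdot> g' (i - k) = g' (i - k)" if "k < i" "i \<le> 2 * k"
  proof -
    have "i - k \<in> {1..k}" using that by auto
    then show ?thesis by (rule inverse(2))
  qed
  then show "((swap \<odot> swap) \<odot> swap) i = swap i"
    using unit inverse(1)[of i]
    by (auto simp: monomial_mult_def[of _ "swap \<odot> swap"] swap_square) (auto simp: swap_def)
qed

lemma swap_square_T: "swap \<odot> swap \<in> T"
  unfolding T_def by (auto intro: generated_subsemigroup.intros)

section \<open>Matrix units in the generated subsemigroup\<close>

definition diagonal :: "'a monomial \<Rightarrow> bool" where
  "diagonal f \<longleftrightarrow> (\<forall>i j s. f i = Some (j, s) \<longrightarrow> j = i)"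

lemma diagonal_mult: "diagonal e \<Longrightarrow> diagonal f \<Longrightarrow> diagonal (e \<odot> f)"
  unfolding diagonal_def monomial_mult_eq_Some by metis

text \<open>As \<open>rot (n - j)\<close> is inverse to \<open>rot j\<close>, conjugation shifts the
  diagonal of \<open>swap \<odot> swap\<close> cyclically.\<close>

lemma conjugate_swap_square:
  assumes "j < n" "i < n" and p: "p = (i + j) mod n"
  shows "(rot j \<odot> (swap \<odot> swap) \<odot> rot (n - j)) i =
    map_option (\<lambda>(_, s). (i, u \<cdot> s \<cdot> u)) ((swap \<odot> swap) p)"
proof -
  have "p < n" using assms by simp
  have "(p + (n - j)) mod n = (i + j + (n - j)) mod n"
    unfolding p by (rule mod_add_left_eq)
  also have "\<dots> = i" using assms by simp
  finally have "rot (n - j) p = Some (i, u)" using \<open>p < n\<close> by (simp add: rot_def)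
  moreover have "rot j i = Some (p, u)" using assms by (simp add: rot_def)
  ultimately show ?thesis
    by (auto simp: monomial_mult_def[of _ "rot j \<odot> (swap \<odot> swap)"] swap_square)
qed

text \<open>A conjugate of the idempotent \<open>swap \<odot> swap\<close> does it, once a shift
  \<open>j\<close> carries \<open>w\<close> to a vanishing row and \<open>z\<close> beyond
  \<open>2 * k + 1\<close>, where the square is the identity.\<close>

lemma separate_rows:
  assumes "z < n" "w < n" "z \<noteq> w"
  obtains v where "v \<in> T" "diagonal v" "v z = Some (z, u)" "v w = None"
proof -
  have "\<exists>j<n. (w + j) mod n \<in> {0, 2 * k + 1} \<and> 2 * k + 1 < (z + j) mod n"
  \<comment> \<open>Let \<open>c\<close> be the cyclic distance from \<open>w\<close> to
    \<open>z\<close>. If it exceeds \<open>2 * k + 1\<close>, moving \<open>w\<close> to row 0 puts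
    \<open>z\<close> on row \<open>c\<close>. Otherwise \<open>w\<close> is moved to row
    \<open>2 * k + 1\<close> and \<open>z\<close> to row \<open>c + (2 * k + 1)\<close>, which is
    below \<open>n\<close>.\<close>
  proof (cases "2 * k + 1 < (z + (n - w)) mod n")
    case True
    show ?thesis
    \<comment> \<open>The shift has to be below \<open>n\<close>, so for \<open>w = 0\<close> it is
      0 and not \<open>n - w\<close>.\<close>
    proof (cases "w = 0")
      case True
      then show ?thesis using \<open>2 * k + 1 < _\<close> assms by (intro exI[of _ 0]) auto
    next
      case False
      then show ?thesis using \<open>2 * k + 1 < _\<close> assms by (intro exI[of _ "n - w"]) auto
    qed
  next
    case False
    define c where "c = (z + (n - w)) mod n"
    define j where "j = (2 * k + 1 + (n - w)) mod n"
    have "(w + j) mod n = (w + (2 * k + 1 + (n - w))) mod n"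
      unfolding j_def by (rule mod_add_right_eq)
    also have "w + (2 * k + 1 + (n - w)) = 2 * k + 1 + n" using assms by simp
    also have "\<dots> mod n = (2 * k + 1) mod n" by (rule mod_add_self2)
    also have "\<dots> = 2 * k + 1" by (simp add: n_def)
    finally have 1: "(w + j) mod n = 2 * k + 1" .
    have "(z + j) mod n = (z + (2 * k + 1 + (n - w))) mod n"
      unfolding j_def by (rule mod_add_right_eq)
    also have "\<dots> = (c + (2 * k + 1)) mod n"
      unfolding c_def by (simp only: mod_add_left_eq) (simp add: ac_simps)
    also have "\<dots> = c + (2 * k + 1)" using False by (simp add: c_def n_def)
    finally have 2: "(z + j) mod n = c + (2 * k + 1)" .
    \<comment> \<open>The sum \<open>z + (n - w)\<close> lies strictly between 0 and
      \<open>2 * n\<close>; as a multiple of \<open>n\<close> it would equal \<open>n\<close>,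
      giving \<open>z = w\<close>.\<close>
    have "c \<noteq> 0"
    proof
      assume "c = 0"
      then have "n dvd z + (n - w)" by (auto simp: c_def)
      then obtain q where q: "z + (n - w) = n * q" by blast
      consider "q = 0" | "q = 1" | "q \<ge> 2" by linarith
      then show False
      proof cases
        case 3
        then have "n * 2 \<le> n * q" by (intro mult_le_mono2)
        then show False using q assms by linarith
      qed (use q assms in auto)
    qed
    with 1 2 show ?thesis by (intro exI[of _ j]) (auto simp: j_def n_def)
  qed
  then obtain j where j: "j < n" "(w + j) mod n \<in> {0, 2 * k + 1}" "2 * k + 1 < (z + j) mod n"
    by (elim exE conjE)
  let ?v = "rot j \<odot> (swap \<odot> swap) \<odot> rot (n - j)"
  have vT: "?v \<in> T" by (intro T_mult rot_T swap_square_T)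
  have row: "?v i = map_option (\<lambda>(_, s). (i, u \<cdot> s \<cdot> u)) ((swap \<odot> swap) ((i + j) mod n))"
    if "i < n" for i
    using conjugate_swap_square[OF j(1) that refl] .
  have "(z + j) mod n < n" using assms by simp
  then have "?v z = Some (z, u)" using row[OF assms(1)] j(3) unit by (simp add: swap_square)
  moreover have "?v w = None" using row[OF assms(2)] j(2) by (auto simp: swap_square)
  moreover have "diagonal ?v"
    unfolding diagonal_def
  proof (intro allI impI)
    fix i l s assume *: "?v i = Some (l, s)"
    from monomialsD(1)[OF subsetD[OF T_monomials vT] this] * show "l = i" using row by auto
  qed
  ultimately show ?thesis using that vT by blast
qed

text \<open>The matrices separating \<open>z\<close> from each \<open>w\<close> are multiplied
  together; since they are diagonal, a zero row of any factor stays zero in the product.\<close>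

lemma isolate_row:
  assumes "finite W" "W \<subseteq> {..<n}" "z < n" "z \<notin> W"
  shows "\<exists>v\<in>T. diagonal v \<and> v z = Some (z, u) \<and> (\<forall>w\<in>W. v w = None)"
  using assms
proof (induction W)
  case empty
  have "diagonal (rot 0)" by (auto simp: diagonal_def rot_def split: if_splits)
  then show ?case using rot_T[of 0] empty by (intro bexI[of _ "rot 0"]) (auto simp: rot_def)
next
  case (insert w W)
  then obtain v where v: "v \<in> T" "diagonal v" "v z = Some (z, u)" "\<forall>w\<in>W. v w = None" by auto
  obtain v' where v': "v' \<in> T" "diagonal v'" "v' z = Some (z, u)" "v' w = None"
    using separate_rows[of z w] insert by auto
  have "(v \<odot> v') w = None"
    using v(2) v'(4) unfolding diagonal_def by (cases "v w") (auto simp: monomial_mult_eq_None)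
  then show ?case
    using v v' T_mult diagonal_mult unit by (intro bexI[of _ "v \<odot> v'"]) auto
qed

lemma entry_mult: "f j = Some (l, t) \<Longrightarrow> entry i j s \<odot> f = entry i l (s \<cdot> t)"
  by (auto simp: entry_def monomial_mult_def)

lemma entry_unit_T:
  assumes "i < n" "j < n"
  shows "entry i j u \<in> T"
proof -
  obtain v where v: "v \<in> T" "diagonal v" "v i = Some (i, u)" "\<forall>w\<in>{..<n} - {i}. v w = None"
    using isolate_row[of "{..<n} - {i}" i] assms by auto
  have "v = entry i i u"
  proof
    fix l
    have "v l = None" if "l \<noteq> i"
      using v(4) that monomialsD(1)[OF subsetD[OF T_monomials v(1)], of l]
      by (cases "v l") auto
    then show "v l = entry i i u l" using v(3) by (auto simp: entry_def)
  qed
  \<comment> \<open>Having isolated row \<open>i\<close>, a rotation on the right moves its column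
    from \<open>i\<close> to \<open>j\<close>.\<close>
  moreover have "rot (j + (n - i)) i = Some (j, u)" using assms by (simp add: rot_def)
  ultimately have "v \<odot> rot (j + (n - i)) = entry i j u"
    using unit by (simp add: entry_mult)
  then show ?thesis using T_mult[OF v(1) rot_T] by metis
qed

text \<open>Every \<open>s\<close> occurs as some entry \<open>g i\<close> of \<open>swap\<close>;
  matrix units on both sides cut it out and move it to the corner.\<close>

lemma entry_T:
  assumes "s \<in> A"
  shows "entry 0 0 s \<in> T"
proof -
  obtain i where i: "1 \<le> i" "i \<le> k" "s = g i" using assms enum(1) by auto
  have "swap i = Some (i + k, g i)" using i by (simp add: swap_def)
  then have "entry 0 i u \<odot> swap = entry 0 (i + k) s"
    using i assms unit by (simp add: entry_mult)
  moreover have "entry (i + k) 0 u (i + k) = Some (0, u)" by (simp add: entry_def)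
  ultimately have "entry 0 i u \<odot> swap \<odot> entry (i + k) 0 u = entry 0 0 s"
    using assms unit by (simp add: entry_mult)
  moreover have "swap \<in> T" unfolding T_def by (auto intro: generated_subsemigroup.gen)
  moreover have "entry 0 i u \<in> T" "entry (i + k) 0 u \<in> T"
    using i by (auto intro!: entry_unit_T simp: n_def)
  ultimately show ?thesis using T_mult by metis
qed

lemma embedding_T: "semigroup_embedding (entry 0 0) A (\<cdot>) T (\<odot>)"
proof -
  have "entry 0 0 s \<odot> entry 0 0 t = entry 0 0 (s \<cdot> t)" for s t
    by (rule entry_mult) (simp add: entry_def)
  moreover have "inj (entry 0 0)" by (rule injI) (metis entry_def option.inject prod.inject)
  ultimately show ?thesis
    unfolding semigroup_embedding_def using entry_T by (auto intro: inj_on_subset)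
qed

lemma orthodox_T: "orthodox_semigroup T (\<odot>)"
  and generated_T: "generated_by_two_group_elements T (\<odot>)"
proof -
  have "suc_power (\<odot>) (rot 1) n = rot 1"
    using rot_period[of 1] unfolding suc_power_rot by simp
  moreover have "0 < n" by (simp add: n_def)
  moreover have "suc_power (\<odot>) swap 2 = swap" "(0::nat) < 2"
    using swap_cube by (simp_all add: numeral_2_eq_2)
  ultimately show "orthodox_semigroup T (\<odot>)" "generated_by_two_group_elements T (\<odot>)"
    using orthodox_generated_by_two_group_elements[OF semigroup_monomials
        idempotent_monomials_mult[OF orthodox] rot_monomial swap_monomial]
    unfolding T_def by blast+
qed

lemma finite_T: "finite T"
  using finite_subset[OF T_monomials finite_monomials] enum(1) by (metis finite_atLeastAtMost finite_imageI)

section \<open>Identities of the band of idempotents\<close>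

lemma word_value_unit:
  "p \<noteq> [] \<Longrightarrow> (\<And>v. v \<in> set p \<Longrightarrow> \<sigma> v = u) \<Longrightarrow> word_value (\<cdot>) \<sigma> p = u"
  by (induction p rule: list_nonempty_induct)
     (auto simp: word_value_Cons unit)

lemma word_value_single:
  assumes "e \<in> idempotents A (\<cdot>)"
  shows "p \<noteq> [] \<Longrightarrow> w \<in> set p \<Longrightarrow> word_value (\<cdot>) (\<lambda>v. if v = w then e else u) p = e"
proof (induction p rule: list_nonempty_induct)
  case (cons v p)
  have e: "e \<in> A" "e \<cdot> e = e" using assms by (auto simp: idempotents_def)
  note step = word_value_Cons[OF cons.hyps(1)]
  show ?case
  proof (cases "w \<in> set p")
    case True
    then show ?thesis using cons.IH e unit by (simp add: step)
  next
    case False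
    then have "word_value (\<cdot>) (\<lambda>v. if v = w then e else u) p = u"
      using cons.hyps by (intro word_value_unit) auto
    then show ?thesis using cons.prems False e unit by (simp add: step)
  qed
qed simp

text \<open>Such an \<open>e\<close> makes \<open>{u, e}\<close> a two-element semilattice, which detects the content of a word.\<close>

lemma satisfies_identity_content:
  assumes e: "e \<in> idempotents A (\<cdot>)" "e \<noteq> u" and pq: "p \<noteq> []" "q \<noteq> []"
    and "satisfies_identity (idempotents A (\<cdot>)) (\<cdot>) p q"
  shows "set p = set q"
proof -
  have "u \<in> idempotents A (\<cdot>)" using unit by (simp add: idempotents_def)
  then have eq: "word_value (\<cdot>) (\<lambda>v. if v = w then e else u) p
    = word_value (\<cdot>) (\<lambda>v. if v = w then e else u) q" for w
    using assms(5) e(1) unfolding satisfies_identity_def by (simp add: image_subset_iff)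
  have "w \<in> set p \<longleftrightarrow> w \<in> set q" for w
    using eq[of w] word_value_single[OF e(1), of p w] word_value_single[OF e(1), of q w]
      word_value_unit[of p "\<lambda>v. if v = w then e else u"]
      word_value_unit[of q "\<lambda>v. if v = w then e else u"] pq e(2)
    by metis
  then show ?thesis by blast
qed

text \<open>Two words satisfying an identity of \<open>E(A)\<close> have equal content, so in each
  row both values are zero or neither is; in the latter case they agree by the identity in
  \<open>E(A)\<close>. The converse is restriction along the embedding.\<close>

lemma same_identities_T:
  assumes e: "e \<in> idempotents A (\<cdot>)" "e \<noteq> u"
  shows "same_semigroup_identities (idempotents T (\<odot>)) (\<odot>) (idempotents A (\<cdot>)) (\<cdot>)"
  unfolding same_semigroup_identities_def
proof (intro allI impI iffI)
  fix p q :: "nat list" assume pq: "p \<noteq> []" "q \<noteq> []"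
  {
    assume "satisfies_identity (idempotents T (\<odot>)) (\<odot>) p q"
    then show "satisfies_identity (idempotents A (\<cdot>)) (\<cdot>) p q"
      using satisfies_identity_embedding[OF semigroup_idempotents[OF orthodox]
          semigroup_embedding_idempotents[OF embedding_T] pq] by blast
  next
    assume sat: "satisfies_identity (idempotents A (\<cdot>)) (\<cdot>) p q"
    have set: "set p = set q" by (rule satisfies_identity_content[OF e pq sat])
    show "satisfies_identity (idempotents T (\<odot>)) (\<odot>) p q"
      unfolding satisfies_identity_def
    proof (intro allI impI ext)
      fix \<sigma> :: "nat \<Rightarrow> 'a monomial" and i
      assume "range \<sigma> \<subseteq> idempotents T (\<odot>)"
      then have \<sigma>: "range \<sigma> \<subseteq> idempotents (monomials n A) (\<odot>)"
        using T_monomials unfolding idempotents_def by blast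
      \<comment> \<open>Zero entries are replaced by the idempotent \<open>u\<close>, so that
        \<open>\<tau>\<close> is a substitution into \<open>E(A)\<close>.\<close>
      define \<tau> where "\<tau> = (\<lambda>v. case \<sigma> v i of None \<Rightarrow> u | Some (_, s) \<Rightarrow> s)"
      have "\<tau> v \<in> idempotents A (\<cdot>)" for v
        using \<sigma> unit unfolding idempotent_monomials
        by (auto simp: \<tau>_def image_subset_iff idempotents_def split: option.split)
      then have "word_value (\<cdot>) \<tau> p = word_value (\<cdot>) \<tau> q"
        using sat unfolding satisfies_identity_def by (simp add: image_subset_iff)
      then show "word_value (\<odot>) \<sigma> p i = word_value (\<odot>) \<sigma> q i"
        using word_value_monomials[OF pq(1) \<sigma>, of i u] word_value_monomials[OF pq(2) \<sigma>, of i u]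
          set unfolding \<tau>_def by simp
    qed
  }
qed

end

section \<open>Embedding a finite group\<close>

definition rotation :: "nat \<Rightarrow> nat \<Rightarrow> nat" where
  "rotation n i = (if i < n then (i + 1) mod n else i)"

lemma rotation_permutes: "rotation n permutes {..<n}"
proof (rule bij_imp_permutes)
  have "inj_on (rotation n) {..<n}"
    by (rule inj_onI) (auto simp: rotation_def mod_Suc split: if_splits)
  moreover have "rotation n ` {..<n} \<subseteq> {..<n}"
    by (auto simp: rotation_def)
  ultimately show "bij_betw (rotation n) {..<n} {..<n}"
    by (simp add: bij_betw_def endo_inj_surj)
qed (simp add: rotation_def)

lemma rotation_funpow: "(rotation n ^^ j) i = (if i < n then (i + j) mod n else i)"
  by (induction j) (auto simp: rotation_def mod_Suc_eq)

lemma rotation_funpow_self: "rotation n ^^ n = id"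
  by (auto simp: rotation_funpow)

lemma comp_transpose: "inj f \<Longrightarrow> f \<circ> transpose a b = transpose (f a) (f b) \<circ> f"
  by (auto simp: fun_eq_iff transpose_def inj_eq)

text \<open>Conjugating \<open>(0 1)\<close> by the cycle gives all adjacent transpositions,
  conjugating among these gives every \<open>(0 i)\<close>, and then every transposition. Inverses
  are positive powers, so semigroup generation suffices.\<close>

lemma generated_permutations:
  assumes "n \<ge> 2"
  shows "generated_subsemigroup (\<circ>) {rotation n, transpose 0 1} = {p. p permutes {..<n}}"
    (is "?G = ?P")
proof
  have "semigroup_on ?P (\<circ>)"
    by unfold_locales (auto simp: permutes_compose o_assoc)
  then show "?G \<subseteq> ?P"
    using assms by (intro generated_subset) (auto simp: rotation_permutes permutes_swap_id)
next
  define G where "G = ?G"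
  have comp: "p \<circ> q \<in> G" if "p \<in> G" "q \<in> G" for p q
    using that unfolding G_def by (rule generated_subsemigroup.mult)
  have gens: "rotation n \<in> G" "transpose 0 1 \<in> G"
    unfolding G_def by (auto intro: generated_subsemigroup.gen)
  \<comment> \<open>There is no empty product in a semigroup; the identity arises as the square of a
    transposition.\<close>
  have id: "id \<in> G"
    using comp[OF gens(2) gens(2)] by simp
  have pow: "rotation n ^^ j \<in> G" for j
  proof (induction j)
    case 0
    show ?case unfolding funpow.simps by (rule id)
  next
    case (Suc j)
    show ?case unfolding funpow.simps by (rule comp[OF gens(1) Suc.IH])
  qed
  have adjacent: "transpose i (Suc i) \<in> G" if "Suc i < n" for i
    using that
  proof (induction i)
    case 0
    then show ?case using gens(2) by simp
  next
    case (Suc i)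
    \<comment> \<open>The power \<open>n - 1\<close> serves as the inverse of the cycle, so this is
      a conjugation.\<close>
    have "rotation n \<circ> transpose i (Suc i) \<circ> rotation n ^^ (n - 1)
      = transpose (Suc i) (Suc (Suc i)) \<circ> (rotation n \<circ> rotation n ^^ (n - 1))"
      using comp_transpose[OF permutes_inj[OF rotation_permutes[of n]], of i "Suc i"] Suc.prems
      by (simp add: rotation_def o_assoc)
    also have "rotation n \<circ> rotation n ^^ (n - 1) = rotation n ^^ Suc (n - 1)"
      by simp
    also have "\<dots> = id" using assms rotation_funpow_self[of n] by simp
    finally have eq: "rotation n \<circ> transpose i (Suc i) \<circ> rotation n ^^ (n - 1)
      = transpose (Suc i) (Suc (Suc i))" by (simp only: comp_id)
    have "transpose i (Suc i) \<in> G" using Suc by simp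
    from comp[OF comp[OF gens(1) this] pow[of "n - 1"]] show ?case by (simp only: eq)
  qed
  have diag: "transpose a a \<in> G" for a
    using id by (simp only: transpose_same)
  have zero: "transpose 0 i \<in> G" if "i < n" for i
    using that
  proof (induction i)
    case 0
    show ?case by (rule diag)
  next
    case (Suc i)
    show ?case
    \<comment> \<open>For \<open>i = 0\<close> the conjugating transposition would move 0, but the
      claim is then about a generator.\<close>
    proof (cases "i = 0")
      case True
      then show ?thesis using gens(2) by simp
    next
      case False
      then have "transpose i (Suc i) \<circ> transpose 0 i \<circ> transpose i (Suc i) = transpose 0 (Suc i)"
        by (auto simp: fun_eq_iff transpose_def)
      moreover have "transpose i (Suc i) \<in> G" "transpose 0 i \<in> G"
        using adjacent[of i] Suc by simp_all
      ultimately show ?thesis using comp by metis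
    qed
  qed
  have all: "transpose a b \<in> G" if "a < n" "b < n" for a b
  proof (cases "a = 0 \<or> b = 0 \<or> a = b")
    case True
    then show ?thesis
      using zero[OF that(1)] zero[OF that(2)] diag transpose_commute[of 0 a] by metis
  next
    case False
    then have "transpose 0 a \<circ> transpose 0 b \<circ> transpose 0 a = transpose a b"
      by (auto simp: fun_eq_iff transpose_def)
    then show ?thesis using comp zero that by metis
  qed
  show "?P \<subseteq> ?G"
    unfolding G_def[symmetric]
  proof
    fix p assume "p \<in> ?P"
    then have "p permutes {..<n}" by simp
    from this finite_lessThan id show "p \<in> G"
      by (rule permutes_induct) (rule comp[OF all], auto)
  qed
qed

lemma satisfies_identity_singleton:
  assumes "semigroup_on {e} m" "p \<noteq> []" "q \<noteq> []"
  shows "satisfies_identity {e} m p q"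
  unfolding satisfies_identity_def using word_value_closed[OF assms(1)] assms(2,3) by blast

lemma orthodox_permutations:
  "orthodox_semigroup {p. p permutes S} (\<circ>)"
  and idempotents_permutations: "idempotents {p. p permutes S} (\<circ>) = {id}"
proof -
  have "semigroup_on {p. p permutes S} (\<circ>)"
    by unfold_locales (auto simp: permutes_compose o_assoc)
  moreover have "p = p \<circ> inv_into UNIV p \<circ> p" if "p permutes S" for p
    using permutes_inv_o[OF that] by simp
  ultimately have "regular_semigroup {p. p permutes S} (\<circ>)"
    unfolding regular_semigroup_def using permutes_inv by blast
  moreover have "p = id" if "p permutes S" "p \<circ> p = p" for p
    using permutes_inj[OF that(1)] that(2) by (auto simp: fun_eq_iff inj_eq)
  then show "idempotents {p. p permutes S} (\<circ>) = {id}"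
    unfolding idempotents_def by (auto simp: permutes_id)
  ultimately show "orthodox_semigroup {p. p permutes S} (\<circ>)"
    unfolding orthodox_semigroup_def by simp
qed

text \<open>Left translations, numbered by \<open>b\<close> and extended by fixed points. The slack
  in \<open>n\<close> matters for the trivial group, since the generating pair above needs two
  points.\<close>

lemma (in group) cayley:
  assumes "finite (carrier G)" "card (carrier G) \<le> n"
  obtains \<phi> where "semigroup_embedding \<phi> (carrier G) (mult G) {p. p permutes {..<n}} (\<circ>)"
proof -
  obtain b where b: "bij_betw b (carrier G) {..<card (carrier G)}"
    using ex_bij_betw_finite_nat[OF assms(1)] by (auto simp: atLeast0LessThan)
  define N where "N = card (carrier G)"
  define c where "c = inv_into (carrier G) b"
  have bc: "b (c i) = i" "c i \<in> carrier G" if "i < N" for i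
    using bij_betw_inv_into_right[OF b] bij_betw_inv_into[OF b] that
    unfolding c_def N_def by (auto dest: bij_betwE)
  have cb: "c (b x) = x" "b x < N" if "x \<in> carrier G" for x
    using bij_betw_inv_into_left[OF b] b that unfolding c_def N_def by (auto dest: bij_betwE)
  define \<phi> where "\<phi> x i = (if i < N then b (x \<otimes> c i) else i)" for x i
  have hom: "\<phi> (x \<otimes> y) = \<phi> x \<circ> \<phi> y" if "x \<in> carrier G" "y \<in> carrier G" for x y
    using that by (auto simp: \<phi>_def fun_eq_iff bc cb m_assoc)
  have one: "\<phi> \<one> = id"
    by (auto simp: \<phi>_def fun_eq_iff bc)
  have "\<phi> x permutes {..<n}" if x: "x \<in> carrier G" for x
  proof (rule permutes_subset)
    have "\<phi> x \<circ> \<phi> (inv x) = id" "\<phi> (inv x) \<circ> \<phi> x = id"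
      using x hom[of x "inv x"] hom[of "inv x" x] one by simp_all
    then have "bij (\<phi> x)" by (metis o_bij)
    then show "\<phi> x permutes {..<N}"
      by (auto simp: permutes_def \<phi>_def bij_iff)
    show "{..<N} \<subseteq> {..<n}" using assms(2) by (auto simp: N_def)
  qed
  moreover have "inj_on \<phi> (carrier G)"
  proof (rule inj_onI)
    fix x y assume xy: "x \<in> carrier G" "y \<in> carrier G" "\<phi> x = \<phi> y"
    \<comment> \<open>Evaluation at the number of the unit recovers the translating element.\<close>
    have "b x = b y"
      using fun_cong[OF xy(3), of "b \<one>"] xy(1,2) by (simp add: \<phi>_def cb)
    then show "x = y" using cb xy by metis
  qed
  ultimately have "semigroup_embedding \<phi> (carrier G) (mult G) {p. p permutes {..<n}} (\<circ>)"
    unfolding semigroup_embedding_def using hom by auto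
  then show ?thesis by (rule that)
qed

section \<open>Arbitrary finite orthodox semigroups and monoids\<close>

text \<open>The new unit \<open>None\<close> is adjoined even when a unit is present, which treats
  all semigroups, including the empty one, uniformly.\<close>

fun with_unit :: "('a \<Rightarrow> 'a \<Rightarrow> 'a) \<Rightarrow> 'a option \<Rightarrow> 'a option \<Rightarrow> 'a option" where
  "with_unit m None y = y"
| "with_unit m x None = x"
| "with_unit m (Some x) (Some y) = Some (m x y)"

lemma with_unit_None [simp]: "with_unit m x None = x"
  by (cases x) auto

lemma orthodox_with_unit:
  assumes "orthodox_semigroup A m"
  shows "orthodox_semigroup (insert None (Some ` A)) (with_unit m)"
proof -
  interpret semigroup_on A m
    using assms unfolding orthodox_semigroup_def regular_semigroup_def by blast
  have "semigroup_on (insert None (Some ` A)) (with_unit m)"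
    by unfold_locales (auto simp: closed assoc)
  moreover have "\<exists>x\<in>insert None (Some ` A). a = with_unit m (with_unit m a x) a"
    if a: "a \<in> insert None (Some ` A)" for a
  proof (cases a)
    case (Some b)
    then obtain x where "x \<in> A" "b = m (m b x) b"
      using a assms unfolding orthodox_semigroup_def regular_semigroup_def by blast
    then show ?thesis using Some by (intro bexI[of _ "Some x"]) auto
  qed auto
  moreover have "idempotents (insert None (Some ` A)) (with_unit m)
    = insert None (Some ` idempotents A m)"
    by (auto simp: idempotents_def)
  ultimately show ?thesis
    using assms unfolding orthodox_semigroup_def regular_semigroup_def by auto
qed

lemma enumerate_orthodox_monoid:
  assumes orth: "orthodox_semigroup A m" and "finite A"
    and unit: "u \<in> A" "\<And>x. x \<in> A \<Longrightarrow> m u x = x" "\<And>x. x \<in> A \<Longrightarrow> m x u = x"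
  obtains k g g' where "enumerated_orthodox_monoid A m u k g g'"
proof -
  interpret semigroup_on A m
    using orth unfolding orthodox_semigroup_def regular_semigroup_def by blast
  obtain g where "bij_betw g {1..card A} A"
    using ex_bij_betw_nat_finite_1[OF assms(2)] by blast
  then have g: "g ` {1..card A} = A" by (simp add: bij_betw_def)
  have "\<exists>y\<in>A. m (m a y) a = a \<and> m (m y a) y = y" if a: "a \<in> A" for a
  proof -
    obtain x where x: "x \<in> A" "m (m a x) a = a"
      using orth a unfolding orthodox_semigroup_def regular_semigroup_def by metis
    then have *: "m a (m x a) = a" "m a (m x (m a z)) = m a z" if "z \<in> A" for z
      using a that by (metis assoc closed)+
    \<comment> \<open>If \<open>a x a = a\<close>, then \<open>x a x\<close> is an inverse of
      \<open>a\<close> in both senses.\<close>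
    show ?thesis
      using * a x(1) by (intro bexI[of _ "m x (m a x)"]) (auto simp: assoc closed)
  qed
  then obtain inverse where inverse:
    "\<And>a. a \<in> A \<Longrightarrow> inverse a \<in> A \<and> m (m a (inverse a)) a = a \<and> m (m (inverse a) a) (inverse a) = inverse a"
    by metis
  have "g i \<in> A" if "i \<in> {1..card A}" for i
    using g that by blast
  then have "enumerated_orthodox_monoid A m u (card A) g (inverse \<circ> g)"
    by unfold_locales (use orth unit g inverse in auto)
  then show ?thesis by (rule that)
qed

text \<open>Transport to natural numbers, shared by both cases of part (b); the carrier type of the
  constructed \<open>T\<close> differs between them.\<close>

lemma embed_orthodox_monoid:
  fixes S :: "'b monoid" and m :: "'c \<Rightarrow> 'c \<Rightarrow> 'c"
  assumes S: "orthodox_semigroup (carrier S) (mult S)"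
    and T: "orthodox_semigroup T m" "finite T" "two_generated T m"
    and unit: "e \<in> T" "\<And>x. x \<in> T \<Longrightarrow> m e x = x" "\<And>x. x \<in> T \<Longrightarrow> m x e = x"
    and h: "semigroup_embedding h (carrier S) (mult S) T m"
    and ids: "same_semigroup_identities (idempotents T m) m (idempotents (carrier S) (mult S)) (mult S)"
  shows "\<exists>(T :: nat monoid) h.
    monoid T \<and> finite (carrier T) \<and> orthodox_semigroup (carrier T) (mult T) \<and>
    two_generated (carrier T) (mult T) \<and>
    semigroup_embedding h (carrier S) (mult S) (carrier T) (mult T) \<and>
    same_semigroup_identities
      (idempotents (carrier T) (mult T)) (mult T)
      (idempotents (carrier S) (mult S)) (mult S)"
proof -
  have "semigroup_on T m" using T(1) unfolding orthodox_semigroup_def regular_semigroup_def by blast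
  then obtain f :: "'c \<Rightarrow> nat" and n where "semigroup_isomorphism T m f n"
    using finite_semigroup_nat T(2) by blast
  then interpret semigroup_isomorphism T m f n .
  let ?N = "\<lparr>carrier = f ` T, mult = n, one = f e\<rparr>"
  have "monoid ?N"
    by (rule monoidI) (use unit in \<open>auto simp: hom[symmetric] closed assoc\<close>)
  moreover have "same_semigroup_identities (idempotents (f ` T) n) n (idempotents (carrier S) (mult S)) (mult S)"
    using same_identities_image[OF T(1)] ids unfolding same_semigroup_identities_def by blast
  ultimately show ?thesis
    using orthodox_image[OF T(1)] two_generated_image[OF T(3)] T(2)
      semigroup_embedding_comp[OF h embedding]
    by (intro exI[of _ ?N] exI[of _ "f \<circ> h"]) auto
qed

theorem theorem4p6:
  "(\<forall>(A :: 'a set) m.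
      finite A \<and> orthodox_semigroup A m \<longrightarrow>
      (\<exists>(B :: nat set) n h.
         finite B \<and> orthodox_semigroup B n \<and>
         generated_by_two_group_elements B n \<and>
         semigroup_embedding h A m B n)) \<and>
   (\<forall>S :: 'b monoid.
      monoid S \<and> finite (carrier S) \<and> orthodox_semigroup (carrier S) (mult S) \<longrightarrow>
      (\<exists>(T :: nat monoid) h.
         monoid T \<and> finite (carrier T) \<and> orthodox_semigroup (carrier T) (mult T) \<and>
         two_generated (carrier T) (mult T) \<and>
         semigroup_embedding h (carrier S) (mult S) (carrier T) (mult T) \<and>
         same_semigroup_identities
           (idempotents (carrier T) (mult T)) (mult T)
           (idempotents (carrier S) (mult S)) (mult S)))"
proof (intro conjI allI impI; elim conjE)
  fix A :: "'a set" and m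
  assume A: "finite A" "orthodox_semigroup A m"
  obtain k g g' where
    "enumerated_orthodox_monoid (insert None (Some ` A)) (with_unit m) None k g g'"
    using enumerate_orthodox_monoid[OF orthodox_with_unit[OF A(2)], of None] A(1) by auto
  then interpret W: enumerated_orthodox_monoid "insert None (Some ` A)" "with_unit m" None k g g' .
  have "semigroup_on W.T W.mm"
    using W.orthodox_T unfolding orthodox_semigroup_def regular_semigroup_def by blast
  then obtain f :: "'a option monomial \<Rightarrow> nat" and n where "semigroup_isomorphism W.T W.mm f n"
    using finite_semigroup_nat W.finite_T by blast
  then interpret F: semigroup_isomorphism W.T W.mm f n .
  have "semigroup_embedding Some A m (insert None (Some ` A)) (with_unit m)"
    unfolding semigroup_embedding_def by auto
  from semigroup_embedding_comp[OF semigroup_embedding_comp[OF this W.embedding_T] F.embedding]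
  show "\<exists>(B :: nat set) n h. finite B \<and> orthodox_semigroup B n \<and>
    generated_by_two_group_elements B n \<and> semigroup_embedding h A m B n"
    using F.orthodox_image[OF W.orthodox_T] W.finite_T
      F.generated_by_two_group_elements_image[OF W.generated_T] by blast
next
  fix S :: "'b monoid"
  assume S: "monoid S" "finite (carrier S)" "orthodox_semigroup (carrier S) (mult S)"
  interpret monoid S by fact
  show "\<exists>(T :: nat monoid) h.
    monoid T \<and> finite (carrier T) \<and> orthodox_semigroup (carrier T) (mult T) \<and>
    two_generated (carrier T) (mult T) \<and>
    semigroup_embedding h (carrier S) (mult S) (carrier T) (mult T) \<and>
    same_semigroup_identities
      (idempotents (carrier T) (mult T)) (mult T)
      (idempotents (carrier S) (mult S)) (mult S)"
  \<comment> \<open>The matrix construction always has the distinct idempotents \<open>rot 0\<close>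
    and \<open>entry 0 0 u\<close>, so it cannot serve when \<open>E(S)\<close> is trivial.\<close>
  proof (cases "\<exists>e\<in>idempotents (carrier S) (mult S). e \<noteq> \<one>\<^bsub>S\<^esub>")
    case True
    then obtain e where e: "e \<in> idempotents (carrier S) (mult S)" "e \<noteq> \<one>\<^bsub>S\<^esub>" by blast
    obtain k g g' where "enumerated_orthodox_monoid (carrier S) (mult S) \<one>\<^bsub>S\<^esub> k g g'"
      using enumerate_orthodox_monoid[OF S(3,2), of "\<one>\<^bsub>S\<^esub>"] by auto
    then interpret W: enumerated_orthodox_monoid "carrier S" "mult S" "\<one>\<^bsub>S\<^esub>" k g g' .
    have "two_generated W.T W.mm"
      using W.generated_T unfolding two_generated_def generated_by_two_group_elements_def by blast
    moreover have "W.mm (W.rot 0) x = x" "W.mm x (W.rot 0) = x" if "x \<in> W.T" for x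
      using W.rot_one W.T_monomials that by blast+
    ultimately show ?thesis
      using embed_orthodox_monoid[OF S(3) W.orthodox_T W.finite_T _ W.rot_T[of 0] _ _
          W.embedding_T W.same_identities_T[OF e]] by blast
  next
    case False
    \<comment> \<open>Regularity makes \<open>y x\<close> idempotent, hence equal to the unit, so
      \<open>S\<close> is a group.\<close>
    have "\<exists>y\<in>carrier S. y \<otimes>\<^bsub>S\<^esub> x = \<one>\<^bsub>S\<^esub>" if x: "x \<in> carrier S" for x
    proof -
      obtain y where y: "y \<in> carrier S" "x = x \<otimes>\<^bsub>S\<^esub> y \<otimes>\<^bsub>S\<^esub> x"
        using S(3) x unfolding orthodox_semigroup_def regular_semigroup_def by blast
      then have "y \<otimes>\<^bsub>S\<^esub> x \<in> idempotents (carrier S) (mult S)"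
        using x unfolding idempotents_def by (simp add: m_assoc)
      then show ?thesis using False y(1) by blast
    qed
    then interpret group S by (rule group_l_invI)
    \<comment> \<open>Adding 2 guarantees the two points that the transposition \<open>(0 1)\<close>
      needs.\<close>
    let ?n = "card (carrier S) + 2"
    let ?P = "{p. p permutes {..<?n}}"
    obtain h where h: "semigroup_embedding h (carrier S) (mult S) ?P (\<circ>)"
      using cayley[OF S(2), of ?n] by auto
    have "two_generated ?P (\<circ>)"
      unfolding two_generated_def
      using generated_permutations[of ?n] rotation_permutes[of ?n]
        permutes_swap_id[of 0 "{..<?n}" 1] by auto
    moreover have "idempotents (carrier S) (mult S) = {\<one>\<^bsub>S\<^esub>}"
      using False by (auto simp: idempotents_def)
    then have "same_semigroup_identities (idempotents ?P (\<circ>)) (\<circ>)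
        (idempotents (carrier S) (mult S)) (mult S)"
      using semigroup_idempotents[OF S(3)] semigroup_idempotents[OF orthodox_permutations]
        satisfies_identity_singleton
      unfolding same_semigroup_identities_def idempotents_permutations by metis
    ultimately show ?thesis
      using embed_orthodox_monoid[OF S(3) orthodox_permutations, of "{..<?n}" id] h
        finite_permutations[of "{..<?n}"]
      by (auto simp: permutes_id)
  qed
qed

end
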